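(* Let $n\ge k\ge 2$ be integers, let $P$ be a $(k-1)$-dimensional polytope and let $p\in P$. Let $F(P)$ denote the set of non-empty proper faces of $P$. Assume that for every $\tau\in F(P)$ we are given $n$ points $y_\tau^1,\dots,y_\tau^n\in \tau$, and that we are given closed sets $(A^i_\tau \mid i\in [n],\ \tau\in F(P))$ of $P$ forming a $k$-weakly Komiya cover of $P$, i.e. for every $I\subseteq[n]$ with $|I|=n-k+1$ and every face $\sigma$ of $P$ we have $\sigma\subseteq \bigcup_{\tau\in F(P),\,\tau\subseteq\sigma}\ \bigcup_{j\in I}A^j_\tau$. Then there exist an injection $\pi:[k]\to[n]$ and faces $\tau_1,\dots,\tau_k\in F(P)$ such that $p\in \mathrm{conv}\{y^{\pi(1)}_{\tau_1},\dots,y^{\pi(k)}_{\tau_k}\}$ and $\bigcap_{i=1}^k A^{\pi(i)}_{\tau_i}\neq\emptyset$.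
   Context: A family $(A_\tau\mid \tau\in F(P))$ of subsets of $P$ is a Komiya cover of $P$ if $\sigma\subseteq\bigcup_{\tau\subseteq\sigma}A_\tau$ for every face $\sigma$ of $P$ (including $\sigma=P$). For $n\ge k,m$, a family of closed sets $(A^i_\sigma\mid i\in[n],\sigma\in F(P))$ is an $m$-weakly Komiya cover of $P$ if for every $I\in\binom{[n]}{n-m+1}$ the family $(\bigcup_{j\in I}A^j_\sigma\mid\sigma\in F(P))$ is a Komiya cover of $P$. *)

theory Defs
  imports "HOL-Analysis.Analysis"
begin

definition proper_faces :: "'a::euclidean_space set \<Rightarrow> 'a set set" where
  "proper_faces P = {\<tau>. \<tau> face_of P \<and> \<tau> \<noteq> {} \<and> \<tau> \<noteq> P}"

definition komiya_cover :: "'a::euclidean_space set \<Rightarrow> ('a set \<Rightarrow> 'a set) \<Rightarrow> bool" where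
  "komiya_cover P A \<longleftrightarrow>
     (\<forall>\<sigma>. \<sigma> face_of P \<longrightarrow> \<sigma> \<subseteq> (\<Union>\<tau>\<in>{\<tau>\<in>proper_faces P. \<tau> \<subseteq> \<sigma>}. A \<tau>))"

definition weakly_komiya_cover ::
  "nat \<Rightarrow> nat \<Rightarrow> 'a::euclidean_space set \<Rightarrow> (nat \<Rightarrow> 'a set \<Rightarrow> 'a set) \<Rightarrow> bool" where
  "weakly_komiya_cover n m P A \<longleftrightarrow>
     (\<forall>i\<in>{1..n}. \<forall>\<tau>\<in>proper_faces P. closed (A i \<tau>) \<and> A i \<tau> \<subseteq> P) \<and>
     (\<forall>I. I \<subseteq> {1..n} \<and> card I = n - m + 1 \<longrightarrow>
          komiya_cover P (\<lambda>\<tau>. \<Union>j\<in>I. A j \<tau>))"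

end

theory Submission
  imports Defs
begin

text \<open>
  Instead of a triangulation of \<open>P\<close> we use a fine cubical grid on its affine hull \<open>H\<close>, so that
  no compatibility with the faces of \<open>P\<close> is needed: a point \<open>u\<close> of \<open>H\<close> inherits the colours
  and faces of its nearest point \<open>r(u)\<close> in \<open>P\<close>. By the covering hypothesis at least \<open>k\<close> colours are
  available at every \<open>u\<close>. Let \<open>S(e)\<close> be the set of colours available somewhere on the closed cell
  \<open>e\<close>, and give \<open>e\<close> the \<open>(k - dim e)\<close>-th smallest colour of \<open>S(e)\<close>. Since \<open>S\<close> is monotone,
  these colours strictly decrease along chains of cells. A partition of unity
  in which the cells active at a point form a chain turns the corresponding points \<open>y\<close> into a
  continuous map \<open>f\<close> with rainbow values. Brouwer's theorem, in the form of the variational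
  inequality for \<open>f - p\<close> on a large ball in \<open>H\<close>, and a limit over finer and finer grids give a point
  \<open>x\<close> and a limit value \<open>w\<close>. The faces used lie in the supporting hyperplane of \<open>P\<close> at \<open>r(x)\<close>
  with normal \<open>x - r(x)\<close>, and this forces \<open>w = p\<close>.
\<close>

text \<open>Elements are added in increasing order: old ranks persist, and the new maximum has as
  rank the number of earlier elements.\<close>

lemma exists_with_card_less:
  fixes S :: "'a::linorder set"
  assumes "finite S" "a < card S"
  shows "\<exists>j\<in>S. card {i \<in> S. i < j} = a"
  using assms
proof (induction S rule: finite_linorder_max_induct)
  case (insert b S)
  have nb: "b \<notin> S" using insert.hyps(2) by auto
  show ?case
  proof (cases "a < card S")
    case True
    then obtain j where j: "j \<in> S" "card {i \<in> S. i < j} = a" using insert.IH by auto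
    have "{i \<in> insert b S. i < j} = {i \<in> S. i < j}" using insert.hyps(2) j(1) by force
    with j show ?thesis by (intro bexI[of _ j]) auto
  next
    case False
    with insert.prems insert.hyps(1) nb have "a = card S" by simp
    moreover have "{i \<in> insert b S. i < b} = S" using insert.hyps(2) by auto
    ultimately show ?thesis by (intro bexI[of _ b]) auto
  qed
qed simp

section \<open>Cubical cells: weights and face order\<close>

text \<open>A cell of the grid is coded by an integer vector: an even entry stands for a grid coordinate, an
  odd entry \<open>m\<close> for the open interval from \<open>m - 1\<close> to \<open>m + 1\<close>. The weight is positive at \<open>z\<close> iff
  for some \<open>s\<close> in \<open>(0, 1)\<close> all even entries are within \<open>s\<close> and all odd ones within \<open>1 - s\<close> of \<open>z\<close>.\<close>

definition cell_weight :: "'b set \<Rightarrow> ('b \<Rightarrow> int) \<Rightarrow> ('b \<Rightarrow> real) \<Rightarrow> real" where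
  "cell_weight B e z =
     (\<Prod>b\<in>B. max 0 (1 - \<bar>z b - e b\<bar>)) *
     (\<Prod>b\<in>{b\<in>B. odd (e b)}. \<Prod>c\<in>{c\<in>B. even (e c)}. max 0 (1 - \<bar>z b - e b\<bar> - \<bar>z c - e c\<bar>))"

lemma cell_weight_nonneg: "0 \<le> cell_weight B e z"
  unfolding cell_weight_def by (intro mult_nonneg_nonneg prod_nonneg ballI) auto

lemma cell_weight_pos_iff:
  assumes "finite B"
  shows "0 < cell_weight B e z \<longleftrightarrow>
    (\<forall>b\<in>B. \<bar>z b - e b\<bar> < 1) \<and>
    (\<forall>b\<in>B. \<forall>c\<in>B. odd (e b) \<longrightarrow> even (e c) \<longrightarrow> \<bar>z b - e b\<bar> + \<bar>z c - e c\<bar> < 1)"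
proof -
  have pos: "0 < (\<Prod>i\<in>I. g i) \<longleftrightarrow> (\<forall>i\<in>I. 0 < g i)"
    if "finite I" "\<And>i. i \<in> I \<Longrightarrow> 0 \<le> g i" for I :: "'b set" and g :: "'b \<Rightarrow> real"
    using that by (metis less_le prod_nonneg prod_pos prod_zero_iff)
  have m: "0 < max 0 r \<longleftrightarrow> 0 < r" "0 \<le> max 0 r" for r :: real by auto
  have mult: "0 < r * s \<longleftrightarrow> 0 < r \<and> 0 < s" if "0 \<le> r" "0 \<le> s" for r s :: real
    using that by (simp add: zero_less_mult_iff)
  have "0 < (\<Prod>b\<in>B. max 0 (1 - \<bar>z b - e b\<bar>)) \<longleftrightarrow> (\<forall>b\<in>B. \<bar>z b - e b\<bar> < 1)"
    by (subst pos[OF assms m(2)]) (simp only: m(1) diff_gt_0_iff_gt)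
  moreover have "0 < (\<Prod>b\<in>{b\<in>B. odd (e b)}. \<Prod>c\<in>{c\<in>B. even (e c)}.
        max 0 (1 - \<bar>z b - e b\<bar> - \<bar>z c - e c\<bar>)) \<longleftrightarrow>
      (\<forall>b\<in>{b\<in>B. odd (e b)}. \<forall>c\<in>{c\<in>B. even (e c)}. \<bar>z b - e b\<bar> + \<bar>z c - e c\<bar> < 1)"
    by (subst pos, simp add: assms, intro prod_nonneg ballI m, subst pos, simp add: assms, rule m)
       (simp only: m(1) diff_gt_0_iff_gt less_diff_eq add_0_left add.commute)
  moreover have "0 \<le> (\<Prod>b\<in>B. max 0 (1 - \<bar>z b - e b\<bar>))"
    "0 \<le> (\<Prod>b\<in>{b\<in>B. odd (e b)}. \<Prod>c\<in>{c\<in>B. even (e c)}.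
        max 0 (1 - \<bar>z b - e b\<bar> - \<bar>z c - e c\<bar>))"
    by (intro prod_nonneg ballI m)+
  ultimately show ?thesis
    unfolding cell_weight_def by (subst mult) blast+
qed

lemma continuous_on_cell_weight:
  fixes z :: "'c::topological_space \<Rightarrow> 'b \<Rightarrow> real"
  assumes "\<And>b. b \<in> B \<Longrightarrow> continuous_on K (\<lambda>x. z x b)"
  shows "continuous_on K (\<lambda>x. cell_weight B e (z x))"
  unfolding cell_weight_def by (intro continuous_intros assms) auto

text \<open>The face relation of closed cells: from \<open>e\<close> to \<open>e'\<close>, odd
  entries are kept and an even entry may only move to a neighbouring odd one.\<close>

definition cell_le :: "'b set \<Rightarrow> ('b \<Rightarrow> int) \<Rightarrow> ('b \<Rightarrow> int) \<Rightarrow> bool" where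
  "cell_le B e e' \<longleftrightarrow> (\<forall>b\<in>B. \<bar>e b - e' b\<bar> \<le> 1 \<and> (odd (e b) \<or> even (e' b) \<longrightarrow> e b = e' b))"

text \<open>Entries of equal parity agree, both being within 1 of \<open>z\<close>. If each code
  were odd where the other is even, the two mixed conditions of \<open>cell_weight_pos_iff\<close>
  would sum to less than 2, against the triangle inequality in the two coordinates.\<close>

lemma cell_le_total_at:
  assumes "finite B" "0 < cell_weight B e z" "0 < cell_weight B e' z"
  shows "cell_le B e e' \<or> cell_le B e' e"
proof -
  have lt: "\<bar>z b - e b\<bar> < 1" "\<bar>z b - e' b\<bar> < 1" if "b \<in> B" for b
    using assms that by (auto simp: cell_weight_pos_iff)
  have near: "\<bar>e b - e' b\<bar> \<le> 1" if "b \<in> B" for b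
    using lt[OF that] by linarith
  have same: "e b = e' b" if "b \<in> B" "odd (e b) \<longleftrightarrow> odd (e' b)" for b
    using near[OF that(1)] that(2) by presburger
  have "False" if b: "b \<in> B" "odd (e b)" "even (e' b)" and c: "c \<in> B" "even (e c)" "odd (e' c)" for b c
  proof -
    have "\<bar>z b - e b\<bar> + \<bar>z c - e c\<bar> < 1" "\<bar>z c - e' c\<bar> + \<bar>z b - e' b\<bar> < 1"
      using assms b c by (auto simp: cell_weight_pos_iff)
    moreover have "e b \<noteq> e' b" "e c \<noteq> e' c" using b c by auto
    then have "1 \<le> \<bar>e b - e' b\<bar>" "1 \<le> \<bar>e c - e' c\<bar>" by linarith+
    then have "1 \<le> \<bar>real_of_int (e b) - e' b\<bar>" "1 \<le> \<bar>real_of_int (e c) - e' c\<bar>" by linarith+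
    ultimately show False by linarith
  qed
  then consider "\<forall>b\<in>B. odd (e b) \<longrightarrow> odd (e' b)" | "\<forall>b\<in>B. odd (e' b) \<longrightarrow> odd (e b)" by blast
  then show ?thesis
  proof cases
    case 1
    with near same have "cell_le B e e'" unfolding cell_le_def by blast
    then show ?thesis ..
  next
    case 2
    with near same have "cell_le B e' e" unfolding cell_le_def by (metis abs_minus_commute)
    then show ?thesis ..
  qed
qed

text \<open>Open intervals of radius \<open>s\<close> about even and \<open>1 - s\<close> about odd
  integers tile the line up to endpoints, and each coordinate of \<open>z\<close> is an endpoint for
  only finitely many \<open>s\<close>.\<close>

lemma cell_weight_pos_exists:
  fixes z :: "'b \<Rightarrow> real"
  assumes "finite B"
  obtains e where "0 < cell_weight B e z"
proof -
  have "infinite ({0<..<1::real} - ((\<lambda>b. frac (z b)) ` B \<union> (\<lambda>b. 1 - frac (z b)) ` B))"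
    using assms by (intro Diff_infinite_finite) (auto simp: infinite_Ioo)
  from infinite_imp_nonempty[OF this] obtain s
    where "s \<in> {0<..<1} - ((\<lambda>b. frac (z b)) ` B \<union> (\<lambda>b. 1 - frac (z b)) ` B)"
    by (meson ex_in_conv)
  then have s: "s \<in> {0<..<1}" "\<And>b. b \<in> B \<Longrightarrow> s \<noteq> frac (z b) \<and> s \<noteq> 1 - frac (z b)"
    by (simp_all add: image_iff)
  have "\<exists>e::int. \<bar>z b - e\<bar> < (if even e then s else 1 - s)" if "b \<in> B" for b
  proof -
    define t where "t = frac (z b)"
    have t: "z b = \<lfloor>z b\<rfloor> + t" "0 \<le> t" "t < 1" "s \<noteq> t" "s \<noteq> 1 - t"
      using s(2)[OF that] frac_lt_1[of "z b"] by (simp_all add: t_def) (simp add: frac_def)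
    show ?thesis
    proof (cases "even \<lfloor>z b\<rfloor>")
      case True
      show ?thesis
      proof (cases "t < s")
        case True with t \<open>even _\<close> show ?thesis by (intro exI[of _ "\<lfloor>z b\<rfloor>"]) auto
      next
        case False with t \<open>even _\<close> show ?thesis by (intro exI[of _ "\<lfloor>z b\<rfloor> + 1"]) auto
      qed
    next
      case False
      show ?thesis
      proof (cases "t < 1 - s")
        case True with t \<open>odd _\<close> show ?thesis by (intro exI[of _ "\<lfloor>z b\<rfloor>"]) auto
      next
        case False with t \<open>odd _\<close> show ?thesis by (intro exI[of _ "\<lfloor>z b\<rfloor> + 1"]) auto
      qed
    qed
  qed
  then obtain e :: "'b \<Rightarrow> int" where e: "\<And>b. b \<in> B \<Longrightarrow> \<bar>z b - e b\<bar> < (if even (e b) then s else 1 - s)"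
    by metis
  have "0 < cell_weight B e z"
    unfolding cell_weight_pos_iff[OF assms]
  proof (intro conjI ballI impI)
    fix b c assume "b \<in> B" "c \<in> B" "odd (e b)" "even (e c)"
    then show "\<bar>z b - e b\<bar> + \<bar>z c - e c\<bar> < 1" using e[of b] e[of c] by simp
  next
    fix b assume "b \<in> B"
    then show "\<bar>z b - e b\<bar> < 1" using e[of b] s(1) by (auto split: if_splits)
  qed
  then show ?thesis using that by blast
qed

section \<open>Brouwer's theorem and the rainbow map of one grid\<close>

text \<open>At a Brouwer fixed point of the projection of \<open>x - f x\<close> onto
  \<open>K\<close>, the vector \<open>- f x\<close> is an outer normal of \<open>K\<close>.\<close>

lemma variational_inequality:
  fixes f :: "'a::euclidean_space \<Rightarrow> 'a"
  assumes "compact K" "convex K" "K \<noteq> {}" "continuous_on K f"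
  obtains x where "x \<in> K" "\<And>z. z \<in> K \<Longrightarrow> 0 \<le> f x \<bullet> (z - x)"
proof -
  have cl: "closed K" using assms compact_imp_closed by blast
  have "continuous_on K (\<lambda>x. closest_point K (x - f x))"
    by (intro continuous_on_compose2[OF continuous_on_closest_point[of K UNIV]] continuous_intros
        assms cl) auto
  moreover have "(\<lambda>x. closest_point K (x - f x)) \<in> K \<rightarrow> K"
    using closest_point_in_set[OF cl assms(3)] by auto
  ultimately obtain x where x: "x \<in> K" "closest_point K (x - f x) = x"
    using brouwer[OF assms(1-3)] by blast
  have "0 \<le> f x \<bullet> (z - x)" if "z \<in> K" for z
    using closest_point_dot[OF assms(2) cl that, of "x - f x"] x(2) by simp
  then show ?thesis using that x(1) by blast
qed

lemma rainbow_variational: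
  fixes H K :: "'a::euclidean_space set" and Q :: "'a \<Rightarrow> nat \<Rightarrow> 'l \<Rightarrow> bool"
    and y :: "nat \<Rightarrow> 'l \<Rightarrow> 'a"
  assumes H: "affine H" "aff_dim H = int d"
    and K: "compact K" "convex K" "K \<noteq> {}" "K \<subseteq> H"
    and C: "finite C" "\<And>u. u \<in> H \<Longrightarrow> d < card {j\<in>C. \<exists>t. Q u j t}"
    and "0 < \<delta>"
  obtains x T w where "x \<in> K" "finite T" "card T \<le> d + 1" "inj_on fst T"
    "\<And>j t. (j, t) \<in> T \<Longrightarrow> j \<in> C \<and> (\<exists>u\<in>H. dist u x < \<delta> \<and> Q u j t)"
    "w \<in> convex hull (case_prod y ` T)" "\<And>z. z \<in> K \<Longrightarrow> 0 \<le> (w - p) \<bullet> (z - x)"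
proof -
  obtain a where a: "a \<in> K" "a \<in> H" using K by blast
  have sub: "subspace ((\<lambda>x. x - a) ` H)"
    using affine_diffs_subspace_subtract[OF H(1) a(2)] .
  obtain B where B: "pairwise orthogonal B" "\<And>b. b \<in> B \<Longrightarrow> norm b = 1" "independent B"
      "card B = dim ((\<lambda>x. x - a) ` H)" "span B = (\<lambda>x. x - a) ` H"
    using orthonormal_basis_subspace[OF sub] by metis
  have finB: "finite B" using B(3) independent_imp_finite by blast
  have cardB: "card B = d"
    using aff_dim_eq_dim_subtract[of a H] H(2) B(4) a(2) hull_inc[of a H] by simp
  have ortho: "b \<bullet> c = (if b = c then 1 else 0)" if "b \<in> B" "c \<in> B" for b c
    using B(1,2) that by (auto simp: pairwise_def orthogonal_def dot_square_norm)
  \<comment> \<open>The grid has spacing \<open>2 / N\<close>. In each of the \<open>d\<close>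
    coordinates a point of an active closed cell is within \<open>2 / N\<close> of \<open>x\<close>;
    the summand 1 makes the total less than \<open>\<delta>\<close> and keeps \<open>N\<close>
    positive for \<open>d = 0\<close>.\<close>
  define N where "N = 2 * real d / \<delta> + 1"
  have N: "0 < N" "2 * real d / N < \<delta>"
    using \<open>0 < \<delta>\<close> by (auto simp: N_def field_simps add_pos_nonneg)
  define z where "z x b = N * ((x - a) \<bullet> b)" for x b
  \<comment> \<open>The closed cell of \<open>H\<close> with code \<open>e\<close>; its centre shows
    that it is non-empty.\<close>
  define V where "V e = {u\<in>H. \<forall>b\<in>B. \<bar>z u b - real_of_int (e b)\<bar> \<le> (if odd (e b) then 1 else 0)}" for e
  have V_ne: "V e \<noteq> {}" for e
  proof -
    define u where "u = a + (\<Sum>b\<in>B. (e b / N) *\<^sub>R b)"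
    have "(\<Sum>b\<in>B. (e b / N) *\<^sub>R b) \<in> (\<lambda>x. x - a) ` H"
      unfolding B(5)[symmetric] by (intro span_sum span_scale span_base)
    then have "u \<in> H" unfolding u_def by auto
    moreover have "z u b = e b" if "b \<in> B" for b
    proof -
      have "(\<Sum>c\<in>B. (e c / N) *\<^sub>R c) \<bullet> b = (\<Sum>c\<in>B. if c = b then e b / N else 0)"
        unfolding inner_sum_left using ortho that by (intro sum.cong) auto
      then show ?thesis using N(1) finB that by (simp add: z_def u_def)
    qed
    ultimately have "u \<in> V e" by (simp add: V_def)
    then show ?thesis by blast
  qed
  have V_mono: "V e \<subseteq> V e'" if "cell_le B e e'" for e e'
  proof
    fix u assume u: "u \<in> V e"
    have "\<bar>z u b - e' b\<bar> \<le> (if odd (e' b) then 1 else 0)" if b: "b \<in> B" for b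
    proof (cases "e b = e' b")
      case False
      then have "even (e b)" "odd (e' b)" "\<bar>e b - e' b\<bar> \<le> 1"
        using \<open>cell_le B e e'\<close> b by (auto simp: cell_le_def)
      moreover have "\<bar>z u b - e b\<bar> \<le> (if odd (e b) then 1 else 0)" using u b by (simp add: V_def)
      ultimately show ?thesis by auto
    qed (use u b in \<open>auto simp: V_def\<close>)
    then show "u \<in> V e'" using u by (simp add: V_def)
  qed
  \<comment> \<open>The dimension of the cell.\<close>
  define odds where "odds e = card {b\<in>B. odd (e b)}" for e :: "'a \<Rightarrow> int"
  have odds_le: "odds e \<le> d" for e
    unfolding odds_def cardB[symmetric] using finB by (intro card_mono) auto
  have odds_mono: "odds e \<le> odds e'" if "cell_le B e e'" for e e'
    unfolding odds_def using finB that by (intro card_mono) (auto simp: cell_le_def)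
  have odds_eq: "e b = e' b" if le: "cell_le B e e'" and eq: "odds e = odds e'" and b: "b \<in> B" for e e' b
  proof -
    have "{b\<in>B. odd (e b)} = {b\<in>B. odd (e' b)}"
      using finB le eq by (intro card_subset_eq) (auto simp: cell_le_def odds_def)
    with le b show ?thesis by (auto simp: cell_le_def)
  qed
  define S where "S e = (\<Union>u\<in>V e. {j\<in>C. \<exists>t. Q u j t})" for e
  have finS: "finite (S e)" for e using C(1) by (auto simp: S_def intro: finite_subset)
  \<comment> \<open>Rank is counted from zero, with \<open>d + 1\<close> in the role of
    \<open>k\<close>. The required rank exists even for vertices, since a single point offers more
    than \<open>d\<close> colours.\<close>
  have "\<exists>j t u. u \<in> V e \<and> j \<in> C \<and> Q u j t \<and> card {i\<in>S e. i < j} = d - odds e" for e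
  proof -
    obtain u where u: "u \<in> V e" using V_ne by blast
    then have "d < card {j\<in>C. \<exists>t. Q u j t}" using C(2) by (simp add: V_def)
    also have "\<dots> \<le> card (S e)" using u finS by (intro card_mono) (auto simp: S_def)
    finally have "d - odds e < card (S e)" by simp
    from exists_with_card_less[OF finS this] show ?thesis unfolding S_def by blast
  qed
  then obtain \<kappa> t u where lab: "\<And>e. u e \<in> V e" "\<And>e. \<kappa> e \<in> C" "\<And>e. Q (u e) (\<kappa> e) (t e)"
      "\<And>e. card {i\<in>S e. i < \<kappa> e} = d - odds e"
    by metis
  \<comment> \<open>The rank of a colour can only grow with the cell, whereas the rank prescribed for a cell drops as its dimension grows.\<close>
  have odds_colour: "odds e = odds e'" if le: "cell_le B e e'" and eq: "\<kappa> e = \<kappa> e'" for e e'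
  proof -
    have "card {i\<in>S e. i < \<kappa> e} \<le> card {i\<in>S e'. i < \<kappa> e'}"
      using V_mono[OF le] finS eq by (intro card_mono) (auto simp: S_def)
    then show ?thesis using odds_mono[OF le] odds_le[of e] odds_le[of e'] by (simp add: lab)
  qed
  obtain r where r: "\<And>x. x \<in> K \<Longrightarrow> norm (x - a) \<le> r"
    using compact_imp_bounded[OF K(1)] by (metis bounded_any_center dist_commute dist_norm)
  \<comment> \<open>Scaled coordinates on \<open>K\<close> are at most \<open>N * r\<close> in
    absolute value and active codes are within 1 of them, so finitely many codes suffice.
    \<open>PiE\<close> makes codes that agree on \<open>B\<close> equal.\<close>
  define M where "M = \<lceil>N * r\<rceil> + 1"
  define E where "E = PiE B (\<lambda>_. {-M..M})"
  have finE: "finite E" using finB by (auto simp: E_def intro: finite_PiE)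
  have E_ex: "\<exists>e\<in>E. 0 < cell_weight B e (z x)" if x: "x \<in> K" for x
  proof -
    obtain e where e: "0 < cell_weight B e (z x)" using cell_weight_pos_exists[OF finB] by blast
    have "e b \<in> {-M..M}" if b: "b \<in> B" for b
    proof -
      have "\<bar>(x - a) \<bullet> b\<bar> \<le> r" using Cauchy_Schwarz_ineq2[of "x - a" b] B(2)[OF b] r[OF x] by simp
      then have "\<bar>z x b\<bar> \<le> N * r" using N(1) by (simp add: z_def abs_mult)
      moreover have "\<bar>z x b - e b\<bar> < 1" using e b finB by (simp add: cell_weight_pos_iff)
      ultimately have "\<bar>real_of_int (e b)\<bar> \<le> M" unfolding M_def by linarith
      then show ?thesis by auto
    qed
    then have "restrict e B \<in> E" by (auto simp: E_def)
    moreover have "0 < cell_weight B (restrict e B) (z x)"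
      using e finB by (simp add: cell_weight_pos_iff)
    ultimately show ?thesis by blast
  qed
  define W where "W x = (\<Sum>e\<in>E. cell_weight B e (z x))" for x
  have W: "0 < W x" if "x \<in> K" for x
    using E_ex[OF that] finE cell_weight_nonneg unfolding W_def by (metis sum_pos2)
  define f where "f x = (\<Sum>e\<in>E. (cell_weight B e (z x) / W x) *\<^sub>R y (\<kappa> e) (t e))" for x
  have cont_cw: "continuous_on K (\<lambda>x. cell_weight B e (z x))" for e
    by (intro continuous_on_cell_weight) (auto simp: z_def intro!: continuous_intros)
  have "continuous_on K W" unfolding W_def by (intro continuous_intros cont_cw)
  then have "continuous_on K (\<lambda>x. f x - p)"
    unfolding f_def using W by (intro continuous_intros cont_cw) force+
  then obtain x where x: "x \<in> K" "\<And>z. z \<in> K \<Longrightarrow> 0 \<le> (f x - p) \<bullet> (z - x)"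
    using variational_inequality[OF K(1-3)] by blast
  define E' where "E' = {e\<in>E. 0 < cell_weight B e (z x)}"
  define T where "T = (\<lambda>e. (\<kappa> e, t e)) ` E'"
  have finE': "finite E'" using finE by (simp add: E'_def)
  \<comment> \<open>Active cells form a chain, so their dimensions, between 0 and \<open>d\<close>,
    are distinct.\<close>
  have eqE: "e = e'" if "e \<in> E'" "e' \<in> E'" "odds e = odds e'" for e e'
  proof -
    have "cell_le B e e' \<or> cell_le B e' e"
      using that finB by (intro cell_le_total_at) (auto simp: E'_def)
    then have "\<forall>b\<in>B. e b = e' b" using odds_eq that(3) by metis
    then show ?thesis using that by (auto simp: E'_def E_def intro: PiE_ext)
  qed
  have "card E' \<le> card {0..d}"
    using eqE odds_le by (intro card_inj_on_le[of odds]) (auto simp: inj_on_def)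
  then have cardT: "card T \<le> d + 1"
    using card_image_le[OF finE', of "\<lambda>e. (\<kappa> e, t e)"] by (simp add: T_def)
  have injT: "inj_on fst T"
  proof (rule inj_onI)
    fix s s' assume "s \<in> T" "s' \<in> T" "fst s = fst s'"
    then obtain e e' where e: "s = (\<kappa> e, t e)" "e \<in> E'" "s' = (\<kappa> e', t e')" "e' \<in> E'" "\<kappa> e = \<kappa> e'"
      by (auto simp: T_def)
    have "cell_le B e e' \<or> cell_le B e' e"
      using e finB by (intro cell_le_total_at) (auto simp: E'_def)
    then have "odds e = odds e'" using odds_colour e(5) by metis
    then show "s = s'" using eqE e by blast
  qed
  have near: "dist (u e) x < \<delta>" if e: "e \<in> E'" for e
  proof -
    have uH: "u e \<in> H" and "x \<in> H" using lab(1)[of e] K(4) x(1) by (auto simp: V_def)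
    then have "u e - a \<in> span B" "x - a \<in> span B" unfolding B(5) by auto
    then have "(u e - a) - (x - a) \<in> span B" by (rule span_diff)
    then have "u e - x \<in> span B" by simp
    then have "dist (u e) x = norm (\<Sum>b\<in>B. ((u e - x) \<bullet> b) *\<^sub>R b)"
      using orthonormal_basis_expand[OF B(1,2) _ finB] by (simp add: dist_norm)
    also have "\<dots> \<le> (\<Sum>b\<in>B. norm (((u e - x) \<bullet> b) *\<^sub>R b))" by (rule norm_sum)
    also have "\<dots> \<le> (\<Sum>b\<in>B. 2 / N)"
    proof (intro sum_mono)
      fix b assume b: "b \<in> B"
      have "\<bar>z (u e) b - e b\<bar> \<le> 1" using lab(1)[of e] b by (auto simp: V_def split: if_splits)
      moreover have "\<bar>z x b - e b\<bar> < 1" using e b finB by (simp add: E'_def cell_weight_pos_iff)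
      ultimately have "\<bar>z (u e) b - z x b\<bar> \<le> 2" by linarith
      also have "z (u e) b - z x b = N * ((u e - x) \<bullet> b)"
        by (simp add: z_def inner_diff_left algebra_simps)
      finally show "norm (((u e - x) \<bullet> b) *\<^sub>R b) \<le> 2 / N"
        using N(1) B(2)[OF b] by (simp add: abs_mult field_simps)
    qed
    also have "\<dots> < \<delta>" using N cardB by (simp add: field_simps)
    finally show ?thesis .
  qed
  have "f x = (\<Sum>e\<in>E'. (cell_weight B e (z x) / W x) *\<^sub>R y (\<kappa> e) (t e))"
    unfolding f_def using finE cell_weight_nonneg[of B _ "z x"]
    by (intro sum.mono_neutral_right) (auto simp: E'_def less_le)
  also have "\<dots> \<in> convex hull (case_prod y ` T)"
  proof (rule convex_sum[OF finE' convex_convex_hull])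
    have "W x = (\<Sum>e\<in>E'. cell_weight B e (z x))"
      unfolding W_def using finE cell_weight_nonneg[of B _ "z x"]
      by (intro sum.mono_neutral_right) (auto simp: E'_def less_le)
    then show "(\<Sum>e\<in>E'. cell_weight B e (z x) / W x) = 1"
      using W[OF x(1)] by (simp add: sum_divide_distrib[symmetric])
    show "0 \<le> cell_weight B e (z x) / W x" for e
      using W[OF x(1)] cell_weight_nonneg by (intro divide_nonneg_pos)
    show "y (\<kappa> e) (t e) \<in> convex hull (case_prod y ` T)" if "e \<in> E'" for e
      using that by (intro hull_inc) (force simp: T_def)
  qed
  finally have hull: "f x \<in> convex hull (case_prod y ` T)" .
  have lT: "j \<in> C \<and> (\<exists>u\<in>H. dist u x < \<delta> \<and> Q u j s)" if "(j, s) \<in> T" for j s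
    using that lab near by (fastforce simp: T_def V_def)
  have finT: "finite T" using finE' by (simp add: T_def)
  show ?thesis using that[OF x(1) finT cardT injT lT hull x(2)] .
qed

section \<open>Minimal faces, nearest points and available colours\<close>

definition min_face :: "'a::euclidean_space set \<Rightarrow> 'a \<Rightarrow> 'a set" where
  "min_face P v = \<Inter>{\<sigma>. \<sigma> face_of P \<and> v \<in> \<sigma>}"

lemma mem_min_face: "v \<in> min_face P v"
  by (auto simp: min_face_def)

lemma min_face_face_of:
  assumes "convex P" "v \<in> P"
  shows "min_face P v face_of P"
  unfolding min_face_def using assms face_of_refl[OF assms(1)] by (intro face_of_Inter) auto

text \<open>The supporting hyperplane at the nearest point cuts out a face containing that point,
  hence the minimal face. For \<open>u\<close> in \<open>P\<close> the normal is 0 and that face is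
  \<open>P\<close>.\<close>

lemma min_face_closest_point_normal:
  assumes "convex P" "closed P" "x \<in> min_face P (closest_point P u)" "z \<in> P"
  shows "(u - closest_point P u) \<bullet> (z - x) \<le> 0"
proof -
  define r where "r = closest_point P u"
  have r: "r \<in> P" using closest_point_in_set[of P u] assms by (auto simp: r_def)
  have le: "(u - r) \<bullet> q \<le> (u - r) \<bullet> r" if "q \<in> P" for q
    using closest_point_dot[OF assms(1,2) that, of u] by (simp add: r_def inner_diff_right)
  have "(P \<inter> {q. (u - r) \<bullet> q = (u - r) \<bullet> r}) face_of P"
    using face_of_Int_supporting_hyperplane_le[OF assms(1) le] .
  with r assms(3) have "(u - r) \<bullet> x = (u - r) \<bullet> r"
    unfolding min_face_def r_def[symmetric] by blast
  with le[OF assms(4)] show ?thesis by (simp add: r_def inner_diff_right)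
qed

text \<open>Otherwise at least \<open>n - k + 1\<close> colours would be missing, against the Komiya
  condition for these colours on the minimal face of \<open>v\<close>.\<close>

lemma weakly_komiya_cover_card:
  assumes "weakly_komiya_cover n k P A" "1 \<le> k" "k \<le> n" "convex P" "v \<in> P"
  shows "k \<le> card {j\<in>{1..n}. \<exists>\<tau>. \<tau> \<in> proper_faces P \<and> \<tau> \<subseteq> min_face P v \<and> v \<in> A j \<tau>}"
    (is "k \<le> card ?c")
proof (rule ccontr)
  assume "\<not> k \<le> card ?c"
  moreover have "card ({1..n} - ?c) = n - card ?c" by (subst card_Diff_subset) auto
  ultimately have "n - k + 1 \<le> card ({1..n} - ?c)" using assms by simp
  then obtain I where I: "I \<subseteq> {1..n} - ?c" "card I = n - k + 1"
    by (meson obtain_subset_with_card_n)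
  then have "komiya_cover P (\<lambda>\<tau>. \<Union>j\<in>I. A j \<tau>)"
    using assms(1) unfolding weakly_komiya_cover_def by blast
  then have "v \<in> (\<Union>\<tau>\<in>{\<tau>\<in>proper_faces P. \<tau> \<subseteq> min_face P v}. \<Union>j\<in>I. A j \<tau>)"
    using min_face_face_of[OF assms(4,5)] mem_min_face unfolding komiya_cover_def by blast
  with I(1) show False by blast
qed

section \<open>Limit over finer grids and choice of colours\<close>

theorem theorem1p5:
  fixes P :: "'a::euclidean_space set"
    and p :: 'a
    and n k :: nat
    and y :: "nat \<Rightarrow> 'a set \<Rightarrow> 'a"
    and A :: "nat \<Rightarrow> 'a set \<Rightarrow> 'a set"
  assumes "2 \<le> k" and "k \<le> n"
    and "polytope P" and "aff_dim P = int k - 1"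
    and "p \<in> P"
    and "\<And>\<tau> i. \<tau> \<in> proper_faces P \<Longrightarrow> i \<in> {1..n} \<Longrightarrow> y i \<tau> \<in> \<tau>"
    and "weakly_komiya_cover n k P A"
  shows "\<exists>\<pi> \<tau>s. inj_on \<pi> {1..k} \<and> \<pi> ` {1..k} \<subseteq> {1..n} \<and>
           (\<forall>i\<in>{1..k}. \<tau>s i \<in> proper_faces P) \<and>
           p \<in> convex hull ((\<lambda>i. y (\<pi> i) (\<tau>s i)) ` {1..k}) \<and>
           (\<Inter>i\<in>{1..k}. A (\<pi> i) (\<tau>s i)) \<noteq> {}"
proof -
  have P: "convex P" "closed P" "bounded P" "P \<noteq> {}"
    using assms(3,5) polytope_imp_convex polytope_imp_closed polytope_imp_bounded by auto
  define H where "H = affine hull P"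
  have PH: "P \<subseteq> H" by (simp add: H_def hull_subset)
  have H: "affine H" "aff_dim H = int (k - 1)"
    using assms(1,4) by (auto simp: H_def of_nat_diff)
  have clH: "closed H" by (simp add: H_def)
  define cp where "cp = closest_point P"
  have cpP: "cp u \<in> P" for u using P by (simp add: cp_def closest_point_in_set)
  \<comment> \<open>The ball is open, so points of \<open>P\<close> are at distance less than
    \<open>R\<close> from \<open>p\<close>; this leaves room for the shift by \<open>\<eta>\<close>
    below.\<close>
  obtain R where R: "P \<subseteq> ball p R" using bounded_subset_ballD[OF P(3)] by blast
  define K where "K = cball p R \<inter> H"
  have pK: "p \<in> K" using R assms(5) PH by (auto simp: K_def)
  have K: "compact K" "convex K"
    using H(1) clH by (simp_all add: K_def affine_imp_convex convex_Int compact_Int_closed)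
  have K': "K \<noteq> {}" "K \<subseteq> H" using pK unfolding K_def by blast+
  \<comment> \<open>Only faces inside the minimal face of \<open>cp u\<close> count, so that
    \<open>y j \<tau>\<close> lies in the supporting hyperplane with normal
    \<open>u - cp u\<close>.\<close>
  define Q where "Q u j \<tau> \<longleftrightarrow> \<tau> \<in> proper_faces P \<and> \<tau> \<subseteq> min_face P (cp u) \<and> cp u \<in> A j \<tau>" for u j \<tau>
  have Q: "k - 1 < card {j\<in>{1..n}. \<exists>\<tau>. Q u j \<tau>}" for u
    unfolding Q_def using weakly_komiya_cover_card[OF assms(7) _ assms(2) P(1) cpP[of u]] assms(1) by simp
  have "\<exists>x T w. x \<in> K \<and> card T \<le> k \<and> inj_on fst T \<and>
      (\<forall>j \<tau>. (j, \<tau>) \<in> T \<longrightarrow> j \<in> {1..n} \<and> (\<exists>u. dist u x < 1 / Suc N \<and> Q u j \<tau>)) \<and>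
      w \<in> convex hull (case_prod y ` T) \<and> (\<forall>z\<in>K. 0 \<le> (w - p) \<bullet> (z - x))" for N
  proof -
    have "0 < 1 / real (Suc N)" by simp
    then show ?thesis
    proof (rule rainbow_variational[OF H K K' finite_atLeastAtMost Q, where p = p and y = y])
      fix x T w
      assume 1: "x \<in> K" "card T \<le> k - 1 + 1" "inj_on fst T" "w \<in> convex hull (case_prod y ` T)"
        and 2: "\<And>j \<tau>. (j, \<tau>) \<in> T \<Longrightarrow> j \<in> {1..n} \<and> (\<exists>u\<in>H. dist u x < 1 / real (Suc N) \<and> Q u j \<tau>)"
        and 3: "\<And>z. z \<in> K \<Longrightarrow> 0 \<le> (w - p) \<bullet> (z - x)"
      have "card T \<le> k" using 1(2) assms(1) by simp
      with 1 2 3 show ?thesis by blast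
    qed
  qed
  then obtain x T w where xK: "\<And>N. x N \<in> K" and cardT: "\<And>N. card (T N) \<le> k"
    and injT: "\<And>N. inj_on fst (T N)"
    and T: "\<And>N j \<tau>. (j, \<tau>) \<in> T N \<Longrightarrow> j \<in> {1..n} \<and> (\<exists>u. dist u (x N) < 1 / Suc N \<and> Q u j \<tau>)"
    and wT: "\<And>N. w N \<in> convex hull (case_prod y ` T N)"
    and vi: "\<And>N z. z \<in> K \<Longrightarrow> 0 \<le> (w N - p) \<bullet> (z - x N)"
    by metis
  have finF: "finite (proper_faces P)"
    using finite_polytope_faces[OF assms(3)] by (rule rev_finite_subset) (auto simp: proper_faces_def)
  \<comment> \<open>Only finitely many label sets are possible, so one recurs for infinitely many
    grids and stays fixed in the limit.\<close>
  have "range T \<subseteq> Pow ({1..n} \<times> proper_faces P)" using T by (fastforce simp: Q_def)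
  then have "finite (range T)" using finF by (meson finite_Pow_iff finite_SigmaI finite_atLeastAtMost finite_subset)
  then obtain N0 where "infinite {N. T N = T N0}"
    using pigeonhole_infinite[of UNIV T] by auto
  from infinite_enumerate[OF this] obtain s :: "nat \<Rightarrow> nat"
    where s: "strict_mono s" "\<And>i. T (s i) = T N0" by blast
  define T0 where "T0 = T N0"
  have T0: "j \<in> {1..n}" "\<tau> \<in> proper_faces P" if "(j, \<tau>) \<in> T0" for j \<tau>
    using T[OF that[unfolded T0_def]] by (auto simp: Q_def)
  have finT0: "finite T0"
    using T0 finF by (intro finite_subset[of T0 "{1..n} \<times> proper_faces P"]) auto
  define C where "C = convex hull (case_prod y ` T0)"
  have "compact (K \<times> C)"
    using K(1) finT0 by (intro compact_Times) (auto simp: C_def finite_imp_compact_convex_hull)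
  then have "seq_compact (K \<times> C)" by (rule compact_imp_seq_compact)
  moreover have "w (s i) \<in> C" for i
    using wT[of "s i"] s(2)[of i] by (simp add: C_def T0_def)
  then have "\<forall>i. (x (s i), w (s i)) \<in> K \<times> C" using xK by simp
  ultimately obtain l r where l: "l \<in> K \<times> C" "strict_mono r"
      "((\<lambda>i. (x (s i), w (s i))) \<circ> r) \<longlonglongrightarrow> l"
    by (rule seq_compactE)
  obtain x' w' where [simp]: "l = (x', w')" by fastforce
  define q where "q = s \<circ> r"
  have q: "strict_mono q" "\<And>i. T (q i) = T0"
    using s l(2) by (auto simp: q_def T0_def strict_mono_o)
  have lim: "(\<lambda>i. x (q i)) \<longlonglongrightarrow> x'" "(\<lambda>i. w (q i)) \<longlonglongrightarrow> w'"
    using tendsto_fst[OF l(3)] tendsto_snd[OF l(3)] by (simp_all add: q_def o_def)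
  have vi': "0 \<le> (w' - p) \<bullet> (z - x')" if "z \<in> K" for z
  proof (rule LIMSEQ_le_const)
    show "(\<lambda>i. (w (q i) - p) \<bullet> (z - x (q i))) \<longlonglongrightarrow> (w' - p) \<bullet> (z - x')"
      by (intro tendsto_intros lim)
  qed (use vi that in auto)
  define v where "v = cp x'"
  \<comment> \<open>With the label fixed, closedness of \<open>A j \<tau>\<close> and continuity of
    \<open>cp\<close> carry both facts from nearby points to \<open>x'\<close>.\<close>
  have T0_lim: "v \<in> A j \<tau>" "(x' - v) \<bullet> (z - y j \<tau>) \<le> 0"
    if T0': "(j, \<tau>) \<in> T0" and z: "z \<in> P" for j \<tau> z
  proof -
    have "\<exists>u. dist u (x (q i)) < 1 / Suc (q i) \<and> Q u j \<tau>" for i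
      using T[of j \<tau> "q i"] T0' q(2) by blast
    then obtain u where u: "\<And>i. dist (u i) (x (q i)) < 1 / Suc (q i)" "\<And>i. Q (u i) j \<tau>"
      by metis
    have "(\<lambda>i. 1 / real (Suc (q i))) \<longlonglongrightarrow> 0"
      using LIMSEQ_subseq_LIMSEQ[OF LIMSEQ_Suc[OF lim_1_over_n] q(1)] by (simp add: o_def)
    then have "(\<lambda>i. u i - x (q i)) \<longlonglongrightarrow> 0"
      by (rule Lim_null_comparison[rotated]) (use u(1) in \<open>auto simp: dist_norm less_imp_le\<close>)
    from tendsto_add[OF this lim(1)] have u_lim: "u \<longlonglongrightarrow> x'" by simp
    have "isCont cp x'" unfolding cp_def using P by (intro continuous_at_closest_point)
    from isCont_tendsto_compose[OF this u_lim] have cp_lim: "(\<lambda>i. cp (u i)) \<longlonglongrightarrow> v"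
      by (simp add: v_def)
    have "closed (A j \<tau>)"
      using assms(7) T0[OF T0'] by (auto simp: weakly_komiya_cover_def)
    then show "v \<in> A j \<tau>"
      using closed_sequentially[OF _ _ cp_lim] u(2) by (auto simp: Q_def)
    have "(u i - cp (u i)) \<bullet> (z - y j \<tau>) \<le> 0" for i
      unfolding cp_def using u(2)[of i] assms(6) T0[OF T0'] z P
      by (intro min_face_closest_point_normal) (auto simp: Q_def cp_def)
    then show "(x' - v) \<bullet> (z - y j \<tau>) \<le> 0"
      by (intro LIMSEQ_le_const2[of "\<lambda>i. (u i - cp (u i)) \<bullet> (z - y j \<tau>)"])
         (auto intro!: tendsto_intros u_lim cp_lim)
  qed
  have w'C: "w' \<in> C" using l(1) by simp
  \<comment> \<open>Testing with \<open>p\<close> puts every labelled point, hence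
    \<open>w'\<close>, in the half-space bounded by the hyperplane through \<open>p\<close> with
    normal \<open>x' - v\<close>.\<close>
  have "C \<subseteq> {a. (x' - v) \<bullet> p \<le> (x' - v) \<bullet> a}"
    unfolding C_def using T0_lim(2)[OF _ assms(5)]
    by (intro hull_minimal convex_halfspace_ge) (auto simp: inner_diff_right)
  then have n_le: "0 \<le> (x' - v) \<bullet> (w' - p)" using w'C by (auto simp: inner_diff_right)
  have "y j \<tau> \<in> P" if "(j, \<tau>) \<in> T0" for j \<tau>
    using assms(6) T0[OF that] face_of_imp_subset by (fastforce simp: proper_faces_def)
  then have "C \<subseteq> P" unfolding C_def using P(1) by (intro hull_minimal) auto
  then have w'H: "w' \<in> H" using w'C PH by blast
  have vP: "v \<in> P" by (simp add: v_def cpP)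
  \<comment> \<open>This keeps the shifted point within distance \<open>R\<close> of
    \<open>p\<close>; the summand 1 avoids a zero denominator.\<close>
  define \<eta> where "\<eta> = (R - norm (v - p)) / (norm (p - w') + 1)"
  have "norm (v - p) < R" using vP R by (auto simp: dist_norm norm_minus_commute)
  then have \<eta>: "0 < \<eta>" by (simp add: \<eta>_def add_nonneg_pos)
  \<comment> \<open>Testing against a point shifted from \<open>v\<close>, not from \<open>x'\<close>, lets both terms of the inequality have the same sign, even if \<open>x'\<close> lies on the boundary of \<open>K\<close>.\<close>
  define z where "z = v + \<eta> *\<^sub>R (p - w')"
  have "\<eta> * norm (p - w') \<le> \<eta> * (norm (p - w') + 1)" using \<eta> by simp
  also have "\<dots> = R - norm (v - p)"
    using norm_ge_zero[of "p - w'"] by (simp add: \<eta>_def add_nonneg_eq_0_iff)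
  finally have "norm (v - p + \<eta> *\<^sub>R (p - w')) \<le> R"
    using norm_triangle_ineq[of "v - p" "\<eta> *\<^sub>R (p - w')"] \<eta> by simp
  moreover have "z \<in> H" unfolding z_def
    using mem_affine_3_minus[OF H(1)] vP PH assms(5) w'H by blast
  ultimately have "z \<in> K"
    by (simp add: K_def z_def dist_norm norm_minus_commute[of p] add_diff_eq diff_add_eq)
  then have "0 \<le> (w' - p) \<bullet> (z - x')" by (rule vi')
  also have "\<dots> = - ((x' - v) \<bullet> (w' - p)) - \<eta> * ((w' - p) \<bullet> (w' - p))"
    by (simp add: z_def inner_diff_left inner_diff_right inner_add_right inner_commute algebra_simps)
  finally have "\<eta> * ((w' - p) \<bullet> (w' - p)) \<le> 0" using n_le by linarith
  then have "w' = p"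
    using \<eta> by (metis inner_eq_zero_iff inner_ge_zero mult_le_0_iff order_antisym not_less right_minus_eq)
  then have p: "p \<in> convex hull (case_prod y ` T0)" using w'C by (simp add: C_def)
  have injT0: "inj_on fst T0" and cardT0: "card T0 \<le> k" using injT cardT by (auto simp: T0_def)
  \<comment> \<open>\<open>T0\<close> may have fewer than \<open>k\<close> colours. It is filled up
    from the at least \<open>k\<close> colours available at \<open>x'\<close>, which also have sets
    containing \<open>v\<close>.\<close>
  define c where "c = {j\<in>{1..n}. \<exists>\<tau>. Q x' j \<tau>}"
  have "\<exists>J. fst ` T0 \<subseteq> J \<and> J \<subseteq> fst ` T0 \<union> c \<and> card J = k"
  proof (rule exists_subset_between)
    show "card (fst ` T0) \<le> k" using cardT0 card_image_le[OF finT0, of fst] by linarith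
    have "k \<le> card c" using Q[of x'] by (simp add: c_def)
    also have "\<dots> \<le> card (fst ` T0 \<union> c)" using finT0 by (intro card_mono) (auto simp: c_def)
    finally show "k \<le> card (fst ` T0 \<union> c)" .
  qed (use finT0 in \<open>auto simp: c_def\<close>)
  then obtain J where J: "fst ` T0 \<subseteq> J" "J \<subseteq> fst ` T0 \<union> c" "card J = k" by blast
  \<comment> \<open>Colours of \<open>T0\<close> keep their faces, so the points whose hull contains
    \<open>p\<close> survive; added colours take any face available at \<open>x'\<close>.\<close>
  have "\<exists>\<tau>. \<tau> \<in> proper_faces P \<and> v \<in> A j \<tau> \<and> (j \<in> fst ` T0 \<longrightarrow> (j, \<tau>) \<in> T0)" if j: "j \<in> J" for j
  proof (cases "j \<in> fst ` T0")
    case True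
    then show ?thesis using T0 T0_lim(1) assms(5) by fastforce
  next
    case False
    then show ?thesis using j J(2) by (auto simp: c_def Q_def v_def)
  qed
  then obtain \<theta> where \<theta>: "\<And>j. j \<in> J \<Longrightarrow> \<theta> j \<in> proper_faces P" "\<And>j. j \<in> J \<Longrightarrow> v \<in> A j (\<theta> j)"
      "\<And>j. j \<in> J \<Longrightarrow> j \<in> fst ` T0 \<Longrightarrow> (j, \<theta> j) \<in> T0"
    by metis
  have "finite J" using J(3) assms(1) card_ge_0_finite by force
  then obtain \<pi> where \<pi>: "bij_betw \<pi> {1..k} J"
    using ex_bij_betw_nat_finite_1 J(3) by blast
  have \<pi>J: "\<pi> ` {1..k} = J" using \<pi> by (simp add: bij_betw_def)
  have "case_prod y ` T0 \<subseteq> (\<lambda>j. y j (\<theta> j)) ` J"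
  proof
    fix a assume "a \<in> case_prod y ` T0"
    then obtain j \<tau> where j: "a = y j \<tau>" "(j, \<tau>) \<in> T0" by auto
    then have "j \<in> fst ` T0" by force
    then have "j \<in> J" "(j, \<theta> j) \<in> T0" using J(1) \<theta>(3) by auto
    then show "a \<in> (\<lambda>j. y j (\<theta> j)) ` J" using inj_onD[OF injT0, of "(j, \<tau>)" "(j, \<theta> j)"] j by auto
  qed
  also have "\<dots> = (\<lambda>i. y (\<pi> i) (\<theta> (\<pi> i))) ` {1..k}" using \<pi>J by auto
  finally have "p \<in> convex hull ((\<lambda>i. y (\<pi> i) (\<theta> (\<pi> i))) ` {1..k})" using p hull_mono by blast
  moreover have "J \<subseteq> {1..n}" using J(2) T0 by (force simp: c_def)
  moreover have "v \<in> (\<Inter>i\<in>{1..k}. A (\<pi> i) (\<theta> (\<pi> i)))" using \<theta>(2) \<pi>J by blast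
  ultimately show ?thesis
    using \<pi> \<pi>J \<theta>(1) by (intro exI[of _ \<pi>] exI[of _ "\<theta> \<circ> \<pi>"]) (auto simp: bij_betw_def)
qed

end
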